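(* Let $s_1<s_2<s_3<\cdots$ be the increasing enumeration of the set of all natural numbers of the form $2^n3^m$ with $n,m$ non-negative integers (so $s_1=1,\ s_2=2,\ s_3=3,\ s_4=4,\ s_5=6,\ s_6=8,\dots$). Then the set $$\left\{\alpha\in[0,1]:\ \exists\,\varkappa>0\ \ \forall n\in\mathbb{N}\ \ \|s_n\alpha\|>\frac{\varkappa}{\sqrt{n}\,\log(n+1)}\right\}$$ has Hausdorff dimension equal to $1$.
   Context: $\mathbb{N}=\{1,2,3,\dots\}$. For real $x$, $\|x\|$ denotes the distance from $x$ to the nearest integer. *)

theory Defs
  imports "HOL-Analysis.Analysis"
begin

text \<open>
  Hausdorff measure and dimension in a metric space. The library's \<open>diameter\<close> is meaningful only
  for bounded sets, hence the boundedness requirement on covering sets. The exponent \<open>0\<close> is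
  treated separately because \<open>0 powr 0 = 0\<close> in Isabelle: every nonempty set then has weight 1.
\<close>

definition hausdorff_weight :: "real \<Rightarrow> 'a::metric_space set \<Rightarrow> ennreal" where
  "hausdorff_weight d U =
     (if U = {} then 0 else if d = 0 then 1 else ennreal (diameter U powr d))"

definition hausdorff_covers :: "real \<Rightarrow> 'a::metric_space set \<Rightarrow> (nat \<Rightarrow> 'a set) set" where
  "hausdorff_covers \<delta> E =
     {U. (\<forall>i. bounded (U i) \<and> diameter (U i) \<le> \<delta>) \<and> E \<subseteq> (\<Union>i. U i)}"

definition hausdorff_premeasure :: "real \<Rightarrow> real \<Rightarrow> 'a::metric_space set \<Rightarrow> ennreal" where
  "hausdorff_premeasure d \<delta> E = (INF U\<in>hausdorff_covers \<delta> E. \<Sum>i. hausdorff_weight d (U i))"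

definition hausdorff_measure :: "real \<Rightarrow> 'a::metric_space set \<Rightarrow> ennreal" where
  "hausdorff_measure d E = (SUP \<delta>\<in>{0<..}. hausdorff_premeasure d \<delta> E)"

definition hausdorff_dim :: "'a::metric_space set \<Rightarrow> ereal" where
  "hausdorff_dim E = Inf {ereal d |d. d \<ge> 0 \<and> hausdorff_measure d E = 0}"

definition dist_nearest_int :: "real \<Rightarrow> real" where
  "dist_nearest_int x = infdist x \<int>"

text \<open>The library's \<open>enumerate\<close> starts at index 0, whereas here \<open>smooth_seq 1\<close> is the least element.\<close>

definition smooth_seq :: "nat \<Rightarrow> nat" where
  "smooth_seq n = enumerate {2 ^ i * 3 ^ j |i j. True} (n - 1)"

end

theory Submission
  imports Defs "HOL-Library.Discrete_Functions"
begin

text \<open>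
  A Cantor set of full dimension is built by the Peres--Schlag method. Level \<open>k\<close> consists of dyadic
  intervals of length \<open>2\<close> to the power \<open>- level k\<close>, where consecutive levels differ by about
  \<open>2 log\<^sub>2 (level k)\<close>. There are \<open>O(level k log (level k))\<close> numbers \<open>s = 2\<^sup>i3\<^sup>j\<close> between
  \<open>2\<close> to the power \<open>level k\<close> and \<open>2\<close> to the power \<open>level (k + 1)\<close>, and a small multiple of the
  reciprocal of this count is the permitted value of \<open>\<parallel>s\<alpha>\<parallel>\<close>; up to a constant it is
  \<open>1 / (\<surd>n log (n + 1))\<close> for \<open>s = s\<^sub>n\<close>.

  The dangerous points for such \<open>s\<close> are removed only at level \<open>k + 2\<close>, where the intervals have become
  short enough for the count of intervals met by the dangerous set to reflect its measure: inside each
  interval of level \<open>k\<close> at most one eighth of the intervals of level \<open>k + 2\<close> is lost. To make this local,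
  one discards in addition every interval that would lose more than half of its children; by Markov's
  inequality each surviving interval keeps at least a quarter of its children. As the number of
  children tends to infinity, a factor 4 per level costs nothing in dimension.
\<close>

section \<open>Trees of intervals and Hausdorff measure\<close>

lemma card_int_real_interval:
  fixes a b :: real
  shows "finite {i::int. a \<le> of_int i \<and> of_int i \<le> b}"
    and "a \<le> b + 1 \<Longrightarrow> real (card {i::int. a \<le> of_int i \<and> of_int i \<le> b}) \<le> b - a + 1"
proof -
  have eq: "{i::int. a \<le> of_int i \<and> of_int i \<le> b} = {\<lceil>a\<rceil>..\<lfloor>b\<rfloor>}"
    by (auto simp: ceiling_le_iff le_floor_iff)
  show "finite {i::int. a \<le> of_int i \<and> of_int i \<le> b}" by (simp add: eq)
  \<comment> \<open>Slightly reversed endpoints are allowed: the set is then empty, and the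
    assumption keeps the bound \<open>b - a + 1\<close> nonnegative.\<close>
  assume "a \<le> b + 1"
  then show "real (card {i::int. a \<le> of_int i \<and> of_int i \<le> b}) \<le> b - a + 1"
    unfolding eq by (simp add: of_nat_nat) linarith
qed

lemma card_nat_real_interval:
  fixes a b :: real
  shows "finite {i::nat. a \<le> real i \<and> real i \<le> b}"
    and "a \<le> b + 1 \<Longrightarrow> real (card {i::nat. a \<le> real i \<and> real i \<le> b}) \<le> b - a + 1"
proof -
  let ?N = "{i::nat. a \<le> real i \<and> real i \<le> b}"
  let ?Z = "{i::int. a \<le> of_int i \<and> of_int i \<le> b}"
  have sub: "int ` ?N \<subseteq> ?Z" by auto
  have inj: "inj_on int ?N" by (simp add: inj_on_def)
  show "finite ?N"
    using finite_subset[OF sub card_int_real_interval(1)] inj finite_image_iff by blast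
  have "card ?N \<le> card ?Z"
    using card_mono[OF card_int_real_interval(1) sub] card_image[OF inj] by simp
  then show "a \<le> b + 1 \<Longrightarrow> real (card ?N) \<le> b - a + 1"
    using card_int_real_interval(2)[of a b] by linarith
qed

definition node :: "real \<Rightarrow> nat \<Rightarrow> real set" where
  "node L i = {real i / L .. (real i + 1) / L}"

lemma node_mult_subset:
  assumes "L > 0" "R > 0"
  shows "node (L * real R) i \<subseteq> node L (i div R)"
proof -
  have "real (i div R) * R \<le> real i" "real i + 1 \<le> (real (i div R) + 1) * R"
  proof -
    have "(i div R) * R \<le> i" by simp
    then show "real (i div R) * R \<le> real i" by (metis of_nat_le_iff of_nat_mult)
    have "i + 1 \<le> (i div R + 1) * R"
      using assms(2) dividend_less_div_times[of R i] by (simp add: algebra_simps)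
    then have "real (i + 1) \<le> real ((i div R + 1) * R)" by (simp only: of_nat_le_iff)
    then show "real i + 1 \<le> (real (i div R) + 1) * R" by (simp add: algebra_simps)
  qed
  then have "(real (i div R) * R) / (L * R) \<le> real i / (L * R)"
       "(real i + 1) / (L * R) \<le> ((real (i div R) + 1) * R) / (L * R)"
    using assms by (intro divide_right_mono; simp)+
  then have "real (i div R) / L \<le> real i / (L * R)"
       "(real i + 1) / (L * R) \<le> (real (i div R) + 1) / L"
    using assms by simp_all
  then show ?thesis by (auto simp: node_def)
qed

text \<open>Cell \<open>i\<close> can meet the ball only if \<open>i\<close> lies between
  \<open>L * (x - r) - 1\<close> and \<open>L * (x + r)\<close>, an interval of length
  \<open>2 * r * L + 1\<close>.\<close>

lemma card_nodes_meeting_ball: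
  assumes "L > 0" "r > 0"
  shows "finite {i. node L i \<inter> ball x r \<noteq> {}}"
    and "real (card {i. node L i \<inter> ball x r \<noteq> {}}) \<le> 2 * r * L + 2"
proof -
  let ?a = "L * (x - r) - 1" and ?b = "L * (x + r)"
  have sub: "{i. node L i \<inter> ball x r \<noteq> {}} \<subseteq> {i. ?a \<le> real i \<and> real i \<le> ?b}"
  proof clarify
    fix i assume "node L i \<inter> ball x r \<noteq> {}"
    then obtain y where y: "real i / L \<le> y" "y \<le> (real i + 1) / L" "\<bar>x - y\<bar> < r"
      by (auto simp: node_def dist_real_def)
    have "real i \<le> L * y" "L * y \<le> real i + 1"
      using y assms by (auto simp: field_simps)
    moreover have "L * y \<le> L * (x + r)" "L * (x - r) \<le> L * y"
      using y(3) assms by (intro mult_left_mono; linarith)+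
    ultimately show "?a \<le> real i \<and> real i \<le> ?b" by linarith
  qed
  show "finite {i. node L i \<inter> ball x r \<noteq> {}}"
    by (rule finite_subset[OF sub card_nat_real_interval(1)])
  have "real (card {i. node L i \<inter> ball x r \<noteq> {}}) \<le> card {i. ?a \<le> real i \<and> real i \<le> ?b}"
    using card_mono[OF card_nat_real_interval(1) sub] by simp
  also have "\<dots> \<le> ?b - ?a + 1"
  proof (rule card_nat_real_interval(2))
    have "L * r > 0" using assms by simp
    then show "?a \<le> ?b + 1" by (simp add: algebra_simps)
  qed
  also have "\<dots> = 2 * r * L + 2" by (simp add: algebra_simps)
  finally show "real (card {i. node L i \<inter> ball x r \<noteq> {}}) \<le> 2 * r * L + 2" .
qed

lemma sum_UN_le:
  fixes f :: "'a \<Rightarrow> real"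
  assumes "finite N" "\<And>n. n \<in> N \<Longrightarrow> finite (I n)" "\<And>i. f i \<ge> 0"
  shows "sum f (\<Union>n\<in>N. I n) \<le> (\<Sum>n\<in>N. sum f (I n))"
  using assms
proof (induction N rule: finite_induct)
  case (insert n N)
  have "sum f (I n \<union> (\<Union>n\<in>N. I n)) \<le> sum f (I n) + sum f (\<Union>n\<in>N. I n)"
    using insert by (subst sum.union_inter[symmetric]) (auto intro!: sum_nonneg)
  then show ?case using insert by force
qed simp

section \<open>Mass distribution on a tree of nested intervals\<close>

primrec tree_weight :: "(nat \<Rightarrow> nat) \<Rightarrow> (nat \<Rightarrow> nat set) \<Rightarrow> nat \<Rightarrow> nat \<Rightarrow> real" where
  "tree_weight R G 0 i = 1"
| "tree_weight R G (Suc k) i =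
     tree_weight R G k (i div R k) / real (card {i' \<in> G (Suc k). i' div R k = i div R k})"

locale cantor_tree =
  fixes R :: "nat \<Rightarrow> nat" and G :: "nat \<Rightarrow> nat set"
  assumes R_ge_2: "R k \<ge> 2"
    and root: "G 0 = {0}"
    and parent: "i \<in> G (Suc k) \<Longrightarrow> i div R k \<in> G k"
    and children: "j \<in> G k \<Longrightarrow> R k \<le> 4 * card {i \<in> G (Suc k). i div R k = j}"
begin

definition L :: "nat \<Rightarrow> real" where
  "L k = real (\<Prod>j<k. R j)"

text \<open>No branch of the tree is chosen: this is the intersection over all levels of finite
  unions of closed intervals, the form in which compactness applies.\<close>

definition limit_set :: "real set" where
  "limit_set = {x. \<forall>k. \<exists>i\<in>G k. x \<in> node (L k) i}"

abbreviation w :: "nat \<Rightarrow> nat \<Rightarrow> real" where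
  "w \<equiv> tree_weight R G"

text \<open>An outer approximation to the measure of \<open>U\<close>: every node that meets
  \<open>U\<close> counts in full, so the value can only decrease as \<open>k\<close> grows.\<close>

definition mass :: "nat \<Rightarrow> real set \<Rightarrow> real" where
  "mass k U = (\<Sum>i | i \<in> G k \<and> node (L k) i \<inter> U \<noteq> {}. w k i)"

lemma L_0 [simp]: "L 0 = 1"
  by (simp add: L_def)

lemma L_Suc: "L (Suc k) = L k * real (R k)"
  by (simp add: L_def)

lemma L_ge: "L k \<ge> 2 ^ k"
proof (induction k)
  case (Suc k)
  have "2 ^ k * 2 \<le> L k * real (R k)"
  proof (rule mult_mono)
    show "0 \<le> L k" using Suc zero_le_power[of "2::real" k] by linarith
  qed (use Suc R_ge_2[of k] in auto)
  then show ?case by (simp add: L_Suc mult.commute)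
qed simp

lemma L_pos: "L k > 0"
  using L_ge[of k] zero_less_power[of "2::real" k] by linarith

lemma L_mono: "k \<le> l \<Longrightarrow> L k \<le> L l"
proof (induction rule: dec_induct)
  case (step n)
  have "L n * 1 \<le> L n * real (R n)"
    using L_pos[of n] R_ge_2[of n] by (intro mult_left_mono) auto
  then show ?case using step by (simp add: L_Suc)
qed simp

lemma node_Suc_subset: "node (L (Suc k)) i \<subseteq> node (L k) (i div R k)"
  unfolding L_Suc using L_pos R_ge_2[of k] by (intro node_mult_subset) auto

lemma finite_G: "finite (G k)"
proof (induction k)
  case (Suc k)
  have "G (Suc k) \<subseteq> (\<Union>j\<in>G k. {j * R k..<Suc j * R k})"
  proof
    fix i assume i: "i \<in> G (Suc k)"
    have "R k > 0" using R_ge_2[of k] by simp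
    then have "i \<in> {i div R k * R k..<Suc (i div R k) * R k}"
      using dividend_less_div_times[of "R k" i] by (simp add: algebra_simps)
    then show "i \<in> (\<Union>j\<in>G k. {j * R k..<Suc j * R k})"
      using parent[OF i] by blast
  qed
  then show ?case by (rule finite_subset) (use Suc in auto)
qed (simp add: root)

lemma card_children_pos: "j \<in> G k \<Longrightarrow> card {i \<in> G (Suc k). i div R k = j} > 0"
  using children[of j k] R_ge_2[of k] by linarith

lemma w_nonneg: "w k i \<ge> 0"
  by (induction k arbitrary: i) auto

text \<open>Since at least \<open>R k / 4\<close> children survive, each split divides the weight by
  at least \<open>R k / 4\<close>, and the product of the \<open>R k\<close> is
  \<open>L\<close>.\<close>

lemma w_le: "i \<in> G k \<Longrightarrow> w k i \<le> 4 ^ k / L k"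
proof (induction k arbitrary: i)
  case (Suc k)
  let ?c = "card {i' \<in> G (Suc k). i' div R k = i div R k}"
  have j: "i div R k \<in> G k" by (rule parent[OF Suc.prems])
  have c: "real (R k) / 4 \<le> real ?c"
    using children[OF j] by linarith
  have "w k (i div R k) / real ?c \<le> (4 ^ k / L k) / (real (R k) / 4)"
    using c Suc.IH[OF j] L_pos[of k] R_ge_2[of k] w_nonneg by (intro frac_le) auto
  then show ?case by (simp add: L_Suc mult.commute)
qed (simp add: root)

lemma sum_w_children:
  assumes "j \<in> G k"
  shows "(\<Sum>i | i \<in> G (Suc k) \<and> i div R k = j. w (Suc k) i) = w k j"
proof -
  have "(\<Sum>i | i \<in> G (Suc k) \<and> i div R k = j. w (Suc k) i) =
        (\<Sum>i | i \<in> G (Suc k) \<and> i div R k = j. w k j / card {i' \<in> G (Suc k). i' div R k = j})"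
    by (intro sum.cong) auto
  then show ?thesis using card_children_pos[OF assms] by simp
qed

text \<open>A child meeting \<open>U\<close> has a parent meeting \<open>U\<close>, and the children
  of a node share exactly its weight.\<close>

lemma mass_Suc_le: "mass (Suc k) U \<le> mass k U"
proof -
  let ?J = "{j \<in> G k. node (L k) j \<inter> U \<noteq> {}}"
  have "mass (Suc k) U \<le>
      (\<Sum>i \<in> (\<Union>j\<in>?J. {i \<in> G (Suc k). i div R k = j}). w (Suc k) i)"
    unfolding mass_def
  proof (rule sum_mono2)
    show "finite (\<Union>j\<in>?J. {i \<in> G (Suc k). i div R k = j})"
      using finite_G by auto
    show "{i. i \<in> G (Suc k) \<and> node (L (Suc k)) i \<inter> U \<noteq> {}}
        \<subseteq> (\<Union>j\<in>?J. {i \<in> G (Suc k). i div R k = j})"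
      using parent node_Suc_subset by fastforce
  qed (rule w_nonneg)
  also have "\<dots> = (\<Sum>j\<in>?J. \<Sum>i | i \<in> G (Suc k) \<and> i div R k = j. w (Suc k) i)"
    using finite_G by (intro sum.UNION_disjoint) auto
  also have "\<dots> = mass k U"
    unfolding mass_def by (intro sum.cong refl sum_w_children) auto
  finally show ?thesis .
qed

lemma mass_antimono: "k \<le> l \<Longrightarrow> mass l U \<le> mass k U"
proof (induction rule: dec_induct)
  case (step n)
  then show ?case using mass_Suc_le[of n U] by linarith
qed simp

lemma sum_w: "(\<Sum>i\<in>G k. w k i) = 1"
proof (induction k)
  case (Suc k)
  have "G (Suc k) = (\<Union>j\<in>G k. {i \<in> G (Suc k). i div R k = j})"
    using parent by auto
  then have "(\<Sum>i\<in>G (Suc k). w (Suc k) i) =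
      (\<Sum>i \<in> (\<Union>j\<in>G k. {i \<in> G (Suc k). i div R k = j}). w (Suc k) i)"
    by simp
  also have "\<dots> = (\<Sum>j\<in>G k. \<Sum>i | i \<in> G (Suc k) \<and> i div R k = j. w (Suc k) i)"
    using finite_G by (intro sum.UNION_disjoint) auto
  also have "\<dots> = (\<Sum>j\<in>G k. w k j)"
    by (intro sum.cong refl sum_w_children)
  finally show ?case using Suc by simp
qed (simp add: root)

text \<open>At most \<open>2 * r * L (Suc k) + 2\<close>, hence at most
  \<open>4 * r * L (Suc k)\<close>, nodes meet the ball, and each weighs at most
  \<open>4 ^ Suc k / L (Suc k)\<close>; the length scale cancels.\<close>

lemma mass_ball_le:
  assumes "1 / L (Suc k) \<le> r"
  shows "mass (Suc k) (ball x r) \<le> 4 * r * 4 ^ Suc k"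
proof -
  have r: "r > 0" using assms L_pos[of "Suc k"] by (auto intro: less_le_trans[of _ "1 / L (Suc k)"])
  have rL: "1 \<le> r * L (Suc k)" using assms L_pos[of "Suc k"] by (simp add: field_simps)
  let ?I = "{i. node (L (Suc k)) i \<inter> ball x r \<noteq> {}}"
  have "mass (Suc k) (ball x r) \<le> real (card (G (Suc k) \<inter> ?I)) * (4 ^ Suc k / L (Suc k))"
    unfolding mass_def Collect_conj_eq Collect_mem_eq
    by (rule sum_bounded_above) (use w_le in blast)
  also have "\<dots> \<le> (4 * r * L (Suc k)) * (4 ^ Suc k / L (Suc k))"
  proof (rule mult_right_mono)
    have "real (card (G (Suc k) \<inter> ?I)) \<le> real (card ?I)"
      using card_mono[OF card_nodes_meeting_ball(1)[OF L_pos[of "Suc k"] r]] by simp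
    also have "\<dots> \<le> 2 * r * L (Suc k) + 2"
      by (rule card_nodes_meeting_ball(2)[OF L_pos r])
    also have "\<dots> \<le> 4 * r * L (Suc k)" using rL by linarith
    finally show "real (card (G (Suc k) \<inter> ?I)) \<le> 4 * r * L (Suc k)" .
  qed (use L_pos[of "Suc k"] in simp)
  also have "\<dots> = 4 * r * 4 ^ Suc k"
    using L_pos[of "Suc k"] by simp
  finally show ?thesis .
qed

text \<open>The Frostman estimate. Split \<open>r\<close> as
  \<open>r powr d * r powr (1 - d)\<close>; since \<open>r < 1 / L k\<close> for a suitable
  \<open>k\<close>, the growth hypothesis lets the second factor absorb \<open>4 ^ Suc k\<close> at
  the cost of \<open>C\<close>.\<close>

lemma eventually_mass_ball_le:
  assumes growth: "\<And>k. 4 ^ Suc k \<le> C * L k powr (1 - d)"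
    and d: "d < 1" and r: "0 < r" "r < 1"
  shows "\<exists>k. \<forall>l\<ge>k. mass l (ball x r) \<le> 4 * C * r powr d"
proof -
  obtain m where m: "1 / r < 2 ^ m" using real_arch_pow[of 2 "1 / r"] by auto
  \<comment> \<open>\<open>Suc k\<close> is the first positive level whose nodes are no longer than
    \<open>r\<close>. Minimality gives \<open>r < 1 / L k\<close>; for \<open>k = 0\<close> this is
    \<open>r < 1\<close>.\<close>
  define k where "k = (LEAST k. 1 / L (Suc k) \<le> r)"
  have "1 / r < L (Suc m)" using m L_ge[of m] L_mono[of m "Suc m"] by linarith
  then have ex: "1 / L (Suc m) \<le> r" using r L_pos[of "Suc m"] by (simp add: field_simps)
  have k1: "1 / L (Suc k) \<le> r" unfolding k_def by (rule LeastI[of _ m]) (rule ex)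
  have k2: "r < 1 / L k"
  proof (cases k)
    case (Suc k')
    then have "\<not> 1 / L (Suc k') \<le> r" unfolding k_def by (intro not_less_Least) simp
    then show ?thesis using Suc by simp
  qed (use r in simp)
  have "r powr (1 - d) \<le> (1 / L k) powr (1 - d)"
    using k2 d r by (intro powr_mono2) auto
  also have "\<dots> = 1 / L k powr (1 - d)" using L_pos[of k] by (simp add: powr_divide)
  finally have "r powr (1 - d) * L k powr (1 - d) \<le> 1" using L_pos[of k] by (simp add: field_simps)
  moreover have C: "C \<ge> 0" using growth[of 0] by simp
  ultimately have "C * (r powr (1 - d) * L k powr (1 - d)) \<le> C * 1"
    by (rule mult_left_mono)
  then have "r powr (1 - d) * (C * L k powr (1 - d)) \<le> C"
    by (simp add: mult.left_commute)
  then have "r powr (1 - d) * 4 ^ Suc k \<le> C"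
    using mult_left_mono[OF growth[of k], of "r powr (1 - d)"] by simp
  then have "4 * r powr d * (r powr (1 - d) * 4 ^ Suc k) \<le> 4 * r powr d * C"
    by (rule mult_left_mono) simp
  moreover have "r powr d * r powr (1 - d) = r"
    using r by (simp flip: powr_add)
  then have "4 * r powr d * (r powr (1 - d) * 4 ^ Suc k) = 4 * r * 4 ^ Suc k"
    by (simp only: mult.assoc[symmetric]) (simp only: mult.assoc)
  ultimately have "4 * r * 4 ^ Suc k \<le> 4 * C * r powr d"
    by (simp only: mult_ac)
  then have "mass (Suc k) (ball x r) \<le> 4 * C * r powr d"
    using mass_ball_le[OF k1, of x] by linarith
  then have "\<forall>l\<ge>Suc k. mass l (ball x r) \<le> 4 * C * r powr d"
    using mass_antimono[of "Suc k" _ "ball x r"] by fastforce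
  then show ?thesis by (rule exI)
qed

text \<open>
  Compactness replaces the limit measure: at a deep enough level finitely many of the balls catch
  every node.
\<close>

lemma open_cover_sum_ge:
  fixes x r :: "nat \<Rightarrow> real"
  assumes growth: "\<And>k. 4 ^ Suc k \<le> C * L k powr (1 - d)"
    and d: "d < 1" and r: "\<And>n. 0 < r n" "\<And>n. r n < 1"
    and cover: "limit_set \<subseteq> (\<Union>n. ball (x n) (r n))"
  shows "\<exists>N. finite N \<and> 1 \<le> 4 * C * (\<Sum>n\<in>N. r n powr d)"
proof -
  define E where "E k = (\<Union>i\<in>G k. node (L k) i)" for k
  define V where "V = (\<Union>n. ball (x n) (r n))"
  have E_Suc: "E (Suc k) \<subseteq> E k" for k
    unfolding E_def using parent node_Suc_subset by fast
  have E_mono: "E l \<subseteq> E k" if "k \<le> l" for k l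
    using that by (induction rule: dec_induct) (use E_Suc in auto)
  have E_compact: "compact (E k)" for k
    unfolding E_def node_def using finite_G by (intro compact_UN) auto
  have "\<exists>k. E k \<subseteq> V"
  proof (rule ccontr)
    assume *: "\<not> ?thesis"
    \<comment> \<open>If no level were covered, the nested nonempty compact sets
      \<open>E k - V\<close> would share a point, which would be an uncovered point of
      \<open>limit_set\<close>.\<close>
    have "\<Inter> (range (\<lambda>k. E k - V)) \<noteq> {}"
    proof (rule compact_nest)
      show "compact (E k - V)" for k
        unfolding V_def by (intro compact_diff E_compact) auto
    qed (use * E_mono in auto)
    then obtain y where "\<And>k. y \<in> E k" "y \<notin> V" by auto
    then have "y \<in> limit_set" by (auto simp: limit_set_def E_def)
    then show False using cover \<open>y \<notin> V\<close> by (auto simp: V_def)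
  qed
  then obtain k where k: "E k \<subseteq> V" ..
  obtain N where N: "finite N" "E k \<subseteq> (\<Union>n\<in>N. ball (x n) (r n))"
    by (rule compactE_image[OF E_compact, of UNIV "\<lambda>n. ball (x n) (r n)" k])
      (use k in \<open>auto simp: V_def\<close>)
  have "\<forall>n. \<exists>k. \<forall>l\<ge>k. mass l (ball (x n) (r n)) \<le> 4 * C * r n powr d"
    using eventually_mass_ball_le[OF growth d r] by blast
  then obtain f where f: "\<And>n l. f n \<le> l \<Longrightarrow> mass l (ball (x n) (r n)) \<le> 4 * C * r n powr d"
    by metis
  \<comment> \<open>A common level, deep enough for the estimate on each of the finitely many balls
    and no coarser than the covered level \<open>k\<close>.\<close>
  define l where "l = Max (insert k (f ` N))"
  have l: "k \<le> l" "\<And>n. n \<in> N \<Longrightarrow> f n \<le> l"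
    unfolding l_def using N(1) by auto
  let ?I = "\<lambda>n. {i \<in> G l. node (L l) i \<inter> ball (x n) (r n) \<noteq> {}}"
  have "G l \<subseteq> (\<Union>n\<in>N. ?I n)"
  proof
    fix i assume i: "i \<in> G l"
    \<comment> \<open>The left endpoint witnesses that the node meets \<open>E k\<close>, hence one
      of the balls.\<close>
    have "real i / L l \<in> node (L l) i" using L_pos[of l] by (auto simp: node_def divide_right_mono)
    moreover from this have "real i / L l \<in> E k" using i E_mono[OF l(1)] by (auto simp: E_def)
    ultimately show "i \<in> (\<Union>n\<in>N. ?I n)" using N(2) i by blast
  qed
  then have "(\<Union>n\<in>N. ?I n) = G l" by auto
  then have "1 \<le> (\<Sum>i\<in>(\<Union>n\<in>N. ?I n). w l i)" by (simp only: sum_w)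
  also have "\<dots> \<le> (\<Sum>n\<in>N. \<Sum>i\<in>?I n. w l i)"
    using N(1) finite_G w_nonneg by (intro sum_UN_le) auto
  also have "\<dots> = (\<Sum>n\<in>N. mass l (ball (x n) (r n)))" by (simp add: mass_def)
  also have "\<dots> \<le> (\<Sum>n\<in>N. 4 * C * r n powr d)" by (intro sum_mono f l)
  finally show ?thesis using N(1) by (auto simp: sum_distrib_left)
qed

end

section \<open>Hausdorff dimension of subsets of the unit interval\<close>

lemma hausdorff_weight_of_pos_exponent:
  "d > 0 \<Longrightarrow> hausdorff_weight d U = ennreal (diameter U powr d)"
  by (simp add: hausdorff_weight_def)

lemma subset_ball_of_diameter_less:
  fixes U :: "'a::metric_space set"
  assumes "bounded U" "diameter U < r"
  shows "\<exists>x. U \<subseteq> ball x r"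
proof (cases "U = {}")
  case False
  then obtain x where "x \<in> U" by blast
  then have "U \<subseteq> ball x r"
    using diameter_bounded_bound[OF assms(1)] assms(2) by fastforce
  then show ?thesis ..
qed simp

text \<open>The mass distribution principle: a cover of too small total weight could be enlarged to
  open balls of small total weight, contradicting \<open>open_cover_sum_ge\<close>.\<close>

lemma (in cantor_tree) hausdorff_measure_pos:
  assumes growth: "\<And>k. 4 ^ Suc k \<le> C * L k powr (1 - d)"
    and d: "0 < d" "d < 1" and F: "limit_set \<subseteq> F"
  shows "hausdorff_measure d F \<noteq> 0"
proof -
  have C: "C \<ge> 4" using growth[of 0] by simp
  \<comment> \<open>Enlarging the cover costs at most another \<open>c\<close>, so the total stays
    below \<open>2 * c\<close>, and \<open>4 * C * (2 * c) = 1\<close>. The bound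
    \<open>c \<le> 1/2\<close> will keep all radii below 1.\<close>
  define c where "c = 1 / (8 * C)"
  have c: "c > 0" "c \<le> 1/2" using C by (simp_all add: c_def field_simps)
  have "ennreal c \<le> hausdorff_premeasure d 1 F"
    unfolding hausdorff_premeasure_def
  proof (rule INF_greatest)
    fix U assume "U \<in> hausdorff_covers 1 F"
    then have U: "\<And>n. bounded (U n)" "F \<subseteq> (\<Union>n. U n)" by (auto simp: hausdorff_covers_def)
    let ?a = "\<lambda>n. diameter (U n) powr d"
    show "ennreal c \<le> (\<Sum>n. hausdorff_weight d (U n))"
    proof (rule ccontr)
      assume "\<not> ?thesis"
      then have lt: "(\<Sum>n. ennreal (?a n)) < ennreal c"
        using d by (simp add: hausdorff_weight_of_pos_exponent)
      then have "(\<Sum>n. ennreal (?a n)) \<noteq> top" using order.strict_trans[OF lt ennreal_less_top] by auto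
      then have summable: "summable ?a" by (intro summable_suminf_not_top) auto
      then have "(\<Sum>n. ennreal (?a n)) = ennreal (suminf ?a)"
        by (intro suminf_ennreal2) auto
      then have a: "suminf ?a < c" using lt summable by (simp add: ennreal_less_iff suminf_nonneg)
      \<comment> \<open>slightly larger weights, so that open balls can replace the covering sets\<close>
      define b where "b n = ?a n + c * (1/2) ^ Suc n" for n
      define r where "r n = b n powr (1 / d)" for n
      have b_pos: "b n > 0" for n using c by (auto simp: b_def intro: add_nonneg_pos)
      have sums: "(\<lambda>n. c * (1/2) ^ Suc n) sums c"
        using sums_mult[OF power_half_series, of c] by simp
      have summable_b: "summable b"
        unfolding b_def by (intro summable_add summable sums_summable[OF sums])
      have sum_b: "sum b N < 2 * c" if "finite N" for N
      proof -
        have "sum b N \<le> suminf b"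
          by (intro sum_le_suminf summable_b that) (use b_pos less_imp_le in auto)
        also have "\<dots> = suminf ?a + c"
          unfolding b_def using suminf_add[OF summable sums_summable[OF sums]] sums_unique[OF sums]
          by simp
        finally show ?thesis using a by linarith
      qed
      have rd: "r n powr d = b n" for n using b_pos[of n] d by (simp add: r_def powr_powr)
      have r_pos: "r n > 0" for n using b_pos[of n] by (simp add: r_def)
      have "b n < 1" for n using sum_b[of "{n}"] c by simp
      then have r_less: "r n < 1" for n
        using powr_less_mono2[of "1 / d" "b n" 1] b_pos[of n] d by (simp add: r_def)
      have "diameter (U n) < r n" for n
      proof -
        have "diameter (U n) powr d < r n powr d" using c by (simp add: rd b_def)
        moreover have "r n powr d \<le> diameter (U n) powr d" if "r n \<le> diameter (U n)"
          using d r_pos[of n] that by (intro powr_mono2) auto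
        ultimately show ?thesis by linarith
      qed
      then have "\<forall>n. \<exists>x. U n \<subseteq> ball x (r n)"
        using subset_ball_of_diameter_less U(1) by blast
      then obtain x where x: "\<And>n. U n \<subseteq> ball (x n) (r n)" by metis
      have "(\<Union>n. U n) \<subseteq> (\<Union>n. ball (x n) (r n))" using x by (rule UN_mono[OF order_refl])
      with F U(2) have "limit_set \<subseteq> (\<Union>n. ball (x n) (r n))" by (meson order.trans)
      from open_cover_sum_ge[OF growth d(2) r_pos r_less this] obtain N
        where N: "finite N" "1 \<le> 4 * C * sum b N"
        unfolding rd by (elim exE conjE)
      have "sum b N < 2 * c" using N(1) by (rule sum_b)
      note N(2)
      moreover have "4 * C * sum b N < 4 * C * (2 * c)"
        using C \<open>sum b N < 2 * c\<close> by (intro mult_strict_left_mono) auto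
      moreover have "4 * C * (2 * c) = 1" using C by (simp add: c_def)
      ultimately show False by linarith
    qed
  qed
  \<comment> \<open>Scale 1 is enough, the measure being a supremum over all scales.\<close>
  also have "\<dots> \<le> hausdorff_measure d F"
    unfolding hausdorff_measure_def by (intro SUP_upper) auto
  finally show ?thesis using c by (auto simp: ennreal_eq_0_iff)
qed

section \<open>Exponent zero, exponents above one, and dimension one\<close>

lemma hausdorff_measure_0_nonempty:
  assumes "F \<noteq> {}"
  shows "hausdorff_measure 0 F \<noteq> 0"
proof -
  have "1 \<le> hausdorff_premeasure 0 1 F"
    unfolding hausdorff_premeasure_def
  proof (rule INF_greatest)
    fix U assume "U \<in> hausdorff_covers 1 F"
    then have "F \<subseteq> (\<Union>n. U n)" by (simp add: hausdorff_covers_def)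
    then obtain n where "U n \<noteq> {}" using assms by blast
    then have "1 = (\<Sum>i\<in>{n}. hausdorff_weight 0 (U i))" by (simp add: hausdorff_weight_def)
    also have "\<dots> \<le> (\<Sum>i. hausdorff_weight 0 (U i))" by (intro sum_le_suminf) auto
    finally show "1 \<le> (\<Sum>i. hausdorff_weight 0 (U i))" .
  qed
  also have "\<dots> \<le> hausdorff_measure 0 F"
    unfolding hausdorff_measure_def by (intro SUP_upper) auto
  finally show ?thesis by auto
qed

lemma hausdorff_measure_empty: "hausdorff_measure d ({} :: 'a::metric_space set) = 0"
proof -
  have "hausdorff_premeasure d \<delta> ({} :: 'a set) = 0" if "\<delta> > 0" for \<delta>
  proof -
    have "(\<lambda>i. {}) \<in> hausdorff_covers \<delta> ({} :: 'a set)"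
      using that by (simp add: hausdorff_covers_def)
    then have "hausdorff_premeasure d \<delta> ({} :: 'a set)
        \<le> (\<Sum>i::nat. hausdorff_weight d ({} :: 'a set))"
      unfolding hausdorff_premeasure_def by (rule INF_lower)
    then show ?thesis by (simp add: hausdorff_weight_def)
  qed
  then show ?thesis by (simp add: hausdorff_measure_def)
qed

lemma hausdorff_premeasure_unit_interval_le:
  assumes d: "d > 0" and N: "N > 0" "1 / real N \<le> \<delta>" and F: "F \<subseteq> {0..1::real}"
  shows "hausdorff_premeasure d \<delta> F \<le> ennreal (2 * real N powr (1 - d))"
proof -
  \<comment> \<open>There are \<open>N + 1\<close> cells, one more than needed for
    \<open>[0, 1)\<close>: the cell with index \<open>N\<close> catches the floor at
    \<open>x = 1\<close>. The factor 2 in the bound comes from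
    \<open>N + 1 \<le> 2 * N\<close>.\<close>
  define U where "U i = (if i \<le> N then node (real N) i else {})" for i
  have diam: "diameter (U i) = (if i \<le> N then 1 / real N else 0)" for i
  proof -
    have "diameter (node (real N) i) = (real i + 1) / N - real i / N"
      using N(1) by (simp add: node_def divide_less_cancel)
    then show ?thesis by (simp add: U_def diff_divide_distrib[symmetric])
  qed
  have "U \<in> hausdorff_covers \<delta> F"
  proof -
    have "F \<subseteq> (\<Union>i. U i)"
    proof
      fix x assume "x \<in> F"
      then have x: "0 \<le> x" "x \<le> 1" using F by auto
      define i where "i = nat \<lfloor>x * N\<rfloor>"
      have i: "real i \<le> x * N" "x * N \<le> real i + 1" using x by (auto simp: i_def)
      moreover have "x * N \<le> N" using x N by (simp add: mult_left_le_one_le)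
      ultimately have "i \<le> N" by linarith
      then have "x \<in> U i" using i N by (simp add: U_def node_def field_simps)
      then show "x \<in> (\<Union>i. U i)" by blast
    qed
    moreover have "bounded (U i)" for i by (simp add: U_def node_def)
    moreover have "diameter (U i) \<le> \<delta>" for i
      using N order.trans[of 0 "1 / real N" \<delta>] by (simp add: diam)
    ultimately show ?thesis by (simp add: hausdorff_covers_def)
  qed
  then have "hausdorff_premeasure d \<delta> F \<le> (\<Sum>i. hausdorff_weight d (U i))"
    unfolding hausdorff_premeasure_def by (rule INF_lower)
  also have "\<dots> = (\<Sum>i\<le>N. hausdorff_weight d (U i))"
    by (intro suminf_finite) (auto simp: U_def hausdorff_weight_def)
  also have "\<dots> = (\<Sum>i\<le>N. ennreal ((1 / real N) powr d))"
    using d by (intro sum.cong) (auto simp: hausdorff_weight_of_pos_exponent diam)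
  also have "\<dots> = ennreal ((real N + 1) * (1 / real N) powr d)"
    by (subst sum_ennreal) (auto simp: algebra_simps)
  also have "\<dots> \<le> ennreal (2 * real N powr (1 - d))"
  proof (rule ennreal_leI)
    have "(real N + 1) * (1 / real N) powr d \<le> (2 * real N) * (1 / real N) powr d"
      using N by (intro mult_right_mono) auto
    also have "\<dots> = 2 * real N powr (1 - d)"
      using N by (simp add: powr_divide powr_diff)
    finally show "(real N + 1) * (1 / real N) powr d \<le> 2 * real N powr (1 - d)" .
  qed
  finally show ?thesis .
qed

lemma hausdorff_measure_unit_interval_subset:
  assumes d: "d > 1" and F: "F \<subseteq> {0..1::real}"
  shows "hausdorff_measure d F = 0"
proof -
  have "hausdorff_premeasure d \<delta> F = 0" if "\<delta> > 0" for \<delta>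
  proof -
    have "(\<lambda>N. real N powr (1 - d)) \<longlonglongrightarrow> 0"
      using d by (intro tendsto_neg_powr filterlim_real_sequentially) auto
    then have "(\<lambda>N. 2 * real N powr (1 - d)) \<longlonglongrightarrow> 2 * 0"
      by (intro tendsto_mult tendsto_const)
    then have lim: "(\<lambda>N. ennreal (2 * real N powr (1 - d))) \<longlonglongrightarrow> 0"
      using tendsto_ennrealI by fastforce
    obtain N0 where N0: "1 / \<delta> \<le> real N0" using real_arch_simple by blast
    have "hausdorff_premeasure d \<delta> F \<le> ennreal (2 * real N powr (1 - d))" if "N \<ge> Suc N0" for N
    proof (rule hausdorff_premeasure_unit_interval_le[OF _ _ _ F])
      have "1 / \<delta> \<le> real N" using N0 that by linarith
      then show "1 / real N \<le> \<delta>" using \<open>\<delta> > 0\<close> that by (simp add: field_simps)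
    qed (use d that in auto)
    then have "hausdorff_premeasure d \<delta> F \<le> 0"
      by (intro LIMSEQ_le_const[OF lim]) blast
    then show ?thesis by simp
  qed
  then show ?thesis by (simp add: hausdorff_measure_def)
qed

text \<open>Exponents above 1 give measure zero for any subset of the unit interval. In the infimum,
  exponent 0 is ruled out by nonemptiness, which follows from \<open>pos\<close> at
  \<open>1/2\<close>.\<close>

lemma hausdorff_dim_eq_1I:
  assumes "F \<subseteq> {0..1::real}"
    and pos: "\<And>d. 0 < d \<Longrightarrow> d < 1 \<Longrightarrow> hausdorff_measure d F \<noteq> 0"
  shows "hausdorff_dim F = 1"
proof (rule antisym)
  show "hausdorff_dim F \<le> 1"
  proof (rule ereal_le_epsilon2)
    fix e :: real assume "e > 0"
    then have "hausdorff_measure (1 + e) F = 0"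
      using hausdorff_measure_unit_interval_subset assms by simp
    then have "hausdorff_dim F \<le> ereal (1 + e)"
      unfolding hausdorff_dim_def using \<open>e > 0\<close>
      by (intro Inf_lower CollectI exI[of _ "1 + e"]) auto
    then show "hausdorff_dim F \<le> 1 + ereal e" unfolding one_ereal_def plus_ereal.simps .
  qed
  have "F \<noteq> {}" using pos[of "1/2"] hausdorff_measure_empty[of "1/2"] by fastforce
  show "1 \<le> hausdorff_dim F"
    unfolding hausdorff_dim_def
  proof (rule Inf_greatest)
    fix y assume "y \<in> {ereal d |d. 0 \<le> d \<and> hausdorff_measure d F = 0}"
    then obtain d where d: "y = ereal d" "0 \<le> d" "hausdorff_measure d F = 0" by blast
    have "d \<noteq> 0" using d(3) hausdorff_measure_0_nonempty[OF \<open>F \<noteq> {}\<close>] by auto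
    then have "d \<ge> 1" using d pos[of d] by force
    then show "1 \<le> y" by (simp add: d(1))
  qed
qed

section \<open>Pruning a tree two levels ahead\<close>

lemma card_div_eq:
  assumes "(R::nat) > 0"
  shows "finite {i. i div R = j}" and "card {i. i div R = j} = R"
proof -
  have "{i. i div R = j} = {j * R..<j * R + R}"
  proof (intro set_eqI iffI)
    fix i assume "i \<in> {i. i div R = j}"
    then show "i \<in> {j * R..<j * R + R}"
      using assms dividend_less_div_times[of R i] by auto
  next
    fix i assume "i \<in> {j * R..<j * R + R}"
    then show "i \<in> {i. i div R = j}"
      using assms by (auto intro!: div_nat_eqI simp: algebra_simps)
  qed
  then show "finite {i. i div R = j}" "card {i. i div R = j} = R" by simp_all
qed

definition heavy :: "(nat \<Rightarrow> nat) \<Rightarrow> (nat \<Rightarrow> nat set) \<Rightarrow> nat \<Rightarrow> nat \<Rightarrow> bool" where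
  "heavy R bad k i \<longleftrightarrow> R k < 2 * card {i' \<in> bad (Suc k). i' div R k = i}"

primrec pruned_tree :: "(nat \<Rightarrow> nat) \<Rightarrow> (nat \<Rightarrow> nat set) \<Rightarrow> nat \<Rightarrow> nat set" where
  "pruned_tree R bad 0 = {0}"
| "pruned_tree R bad (Suc k) =
     {i. i div R k \<in> pruned_tree R bad k \<and> i \<notin> bad (Suc k) \<and> \<not> heavy R bad (Suc k) i}"

text \<open>A node of the tree is not heavy, so at most half of its children are bad. At most a
  quarter are heavy, and the remaining quarter survives.\<close>

lemma cantor_tree_pruned_tree:
  assumes R: "\<And>k. R k \<ge> 2"
    and bad_1: "bad 1 = {}"
    and bad: "\<And>k j. 8 * card {i \<in> bad (Suc (Suc k)). i div R (Suc k) div R k = j} \<le> R k * R (Suc k)"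
  shows "cantor_tree R (pruned_tree R bad)"
proof
  fix k j assume j: "j \<in> pruned_tree R bad k"
  have R0: "R k > 0" for k using R[of k] by simp
  \<comment> \<open>The construction never tests the root; it is not heavy because
    \<open>bad 1\<close> is empty.\<close>
  have not_heavy: "\<not> heavy R bad k j"
    using j bad_1 by (cases k) (auto simp: heavy_def)
  define Ch where "Ch = {i. i div R k = j}"
  define Bd where "Bd = {i \<in> bad (Suc k). i div R k = j}"
  define Hv where "Hv = {i \<in> Ch. heavy R bad (Suc k) i}"
  have Ch: "finite Ch" "card Ch = R k" unfolding Ch_def using card_div_eq R0 by auto
  have Bd: "2 * card Bd \<le> R k" using not_heavy unfolding heavy_def Bd_def by simp
  have fin: "finite {i'. i' div R (Suc k) div R k = j}"
    using card_div_eq(1)[of "R (Suc k) * R k" j] R0 by (simp add: div_mult2_eq)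
  let ?B = "\<lambda>i. {i' \<in> bad (Suc (Suc k)). i' div R (Suc k) = i}"
  \<comment> \<open>Markov's inequality: each heavy child has more than \<open>R (Suc k) / 2\<close>
    bad children, while \<open>j\<close> has at most \<open>R k * R (Suc k) / 8\<close> bad
    grandchildren.\<close>
  have "card Hv * R (Suc k) = (\<Sum>i\<in>Hv. R (Suc k))" by simp
  also have "\<dots> \<le> (\<Sum>i\<in>Hv. 2 * card (?B i))"
    by (intro sum_mono) (auto simp: Hv_def heavy_def)
  also have "\<dots> = 2 * card (\<Union>i\<in>Hv. ?B i)"
  proof -
    have "card (\<Union>i\<in>Hv. ?B i) = (\<Sum>i\<in>Hv. card (?B i))"
    proof (rule card_UN_disjoint)
      show "finite Hv" unfolding Hv_def using Ch by auto
      show "\<forall>i\<in>Hv. finite (?B i)" using card_div_eq(1)[OF R0] by auto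
    qed auto
    then show ?thesis by (simp add: sum_distrib_left)
  qed
  also have "\<dots> \<le> 2 * card {i \<in> bad (Suc (Suc k)). i div R (Suc k) div R k = j}"
    by (intro mult_left_mono card_mono) (use fin in \<open>auto simp: Hv_def Ch_def\<close>)
  finally have "4 * (card Hv * R (Suc k)) \<le> R k * R (Suc k)"
    using bad[of k j] by linarith
  then have "(4 * card Hv) * R (Suc k) \<le> R k * R (Suc k)" by (simp only: mult.assoc)
  then have Hv: "4 * card Hv \<le> R k" using R0[of "Suc k"] by simp
  have "Ch \<subseteq> {i \<in> pruned_tree R bad (Suc k). i div R k = j} \<union> Bd \<union> Hv"
    using j by (auto simp: Ch_def Bd_def Hv_def)
  moreover have "finite ({i \<in> pruned_tree R bad (Suc k). i div R k = j} \<union> Bd \<union> Hv)"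
    using Ch(1) by (rule rev_finite_subset) (auto simp: Ch_def Bd_def Hv_def)
  ultimately have "card Ch \<le> card ({i \<in> pruned_tree R bad (Suc k). i div R k = j} \<union> Bd \<union> Hv)"
    by (rule card_mono[rotated])
  also have "\<dots> \<le> card {i \<in> pruned_tree R bad (Suc k). i div R k = j} + card Bd + card Hv"
    by (meson card_Un_le add_right_mono order.trans)
  finally show "R k \<le> 4 * card {i \<in> pruned_tree R bad (Suc k). i div R k = j}"
    using Ch Bd Hv by linarith
qed (use R in auto)

text \<open>About \<open>s / L\<close> integers \<open>p\<close> are relevant inside node
  \<open>j\<close>. For each, the points with \<open>s * x\<close> within \<open>\<delta>\<close> of
  \<open>p\<close> form an interval of length \<open>2 * \<delta> / s\<close>. The term
  \<open>8 * \<delta> * W\<close> reflects measure, \<open>12 * (s / L)\<close> the cells cut at the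
  ends.\<close>

lemma card_nodes_near_fraction:
  fixes L s \<delta> :: real and W j :: nat
  assumes "L > 0" "W > 0" "s \<ge> L" "\<delta> > 0" "\<delta> \<le> 1"
  shows "finite {i. i div W = j \<and> (\<exists>x\<in>node (L * W) i. \<exists>p::int. \<bar>s * x - p\<bar> \<le> \<delta>)}" (is "finite ?N")
    and "real (card {i. i div W = j \<and> (\<exists>x\<in>node (L * W) i. \<exists>p::int. \<bar>s * x - p\<bar> \<le> \<delta>)})
           \<le> 8 * \<delta> * W + 12 * (s / L)"
proof -
  define Q where "Q = L * W"
  have Q: "Q > 0" and s: "s > 0" using assms by (auto simp: Q_def)
  let ?P = "{p::int. s * (j / L) - \<delta> \<le> p \<and> p \<le> s * ((j + 1) / L) + \<delta>}"
  let ?I = "\<lambda>p::int. {i::nat. (p - \<delta>) * Q / s - 1 \<le> real i \<and> real i \<le> (p + \<delta>) * Q / s}"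
  show "finite ?N"
    by (rule finite_subset[OF _ card_div_eq(1)[OF assms(2), of j]]) auto
  have sub: "?N \<subseteq> (\<Union>p\<in>?P. ?I p)"
  proof
    fix i assume "i \<in> ?N"
    then obtain x and p :: int where j: "i div W = j" and x: "x \<in> node (L * real W) i"
      and p: "\<bar>s * x - p\<bar> \<le> \<delta>" by blast
    have "x \<in> node L j" using x j node_mult_subset[OF assms(1,2)] by auto
    then have "j / L \<le> x" "x \<le> (j + 1) / L" by (auto simp: node_def add.commute)
    then have "s * (j / L) \<le> s * x" "s * x \<le> s * ((j + 1) / L)"
      using s by (simp_all only: mult_le_cancel_left_pos)
    then have "p \<in> ?P" using p unfolding mem_Collect_eq by linarith
    moreover have "p - \<delta> \<le> s * x" "s * x \<le> p + \<delta>" using p by linarith+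
    then have "(p - \<delta>) / s \<le> x" "x \<le> (p + \<delta>) / s"
      using s by (simp_all add: pos_divide_le_eq pos_le_divide_eq mult.commute)
    then have "(p - \<delta>) / s * Q \<le> x * Q" "x * Q \<le> (p + \<delta>) / s * Q"
      using Q by (simp_all only: mult_le_cancel_right_pos)
    then have "(p - \<delta>) * Q / s \<le> x * Q" "x * Q \<le> (p + \<delta>) * Q / s"
      by simp_all
    moreover have "real i \<le> x * Q" "x * Q \<le> real i + 1"
      using x Q by (auto simp: node_def field_simps simp flip: Q_def)
    ultimately show "i \<in> (\<Union>p\<in>?P. ?I p)" by (intro UN_I[of p]) auto
  qed
  have "card ?N \<le> card (\<Union>p\<in>?P. ?I p)"
    by (intro card_mono sub finite_UN_I card_int_real_interval card_nat_real_interval)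
  also have "\<dots> \<le> (\<Sum>p\<in>?P. card (?I p))"
    by (intro card_UN_le card_int_real_interval)
  finally have "real (card ?N) \<le> (\<Sum>p\<in>?P. real (card (?I p)))"
    by (simp flip: of_nat_sum)
  also have "\<dots> \<le> (\<Sum>p\<in>?P. 2 * \<delta> * Q / s + 2)"
  proof (rule sum_mono)
    fix p :: int
    have "(p + \<delta>) * Q / s - ((p - \<delta>) * Q / s - 1) + 1 = 2 * \<delta> * Q / s + 2"
      using s by (simp add: field_simps)
    moreover have "2 * \<delta> * Q / s > 0" using assms Q s by simp
    ultimately show "real (card (?I p)) \<le> 2 * \<delta> * Q / s + 2"
      using card_nat_real_interval(2)[of "(p - \<delta>) * Q / s - 1" "(p + \<delta>) * Q / s"] by linarith
  qed
  also have "\<dots> = real (card ?P) * (2 * \<delta> * Q / s + 2)" by simp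
  also have "\<dots> \<le> (4 * (s / L)) * (2 * \<delta> * Q / s + 3)"
  proof (rule mult_mono)
    \<comment> \<open>As \<open>\<delta> \<le> 1 \<le> s / L\<close>, the excess
      \<open>2 * \<delta> + 1\<close> is at most \<open>3 * (s / L)\<close>.\<close>
    have "1 \<le> s / L" using assms by simp
    moreover have "s * ((j + 1) / L) + \<delta> - (s * (j / L) - \<delta>) + 1 = s / L + 2 * \<delta> + 1"
      using assms by (simp add: field_simps)
    ultimately show "real (card ?P) \<le> 4 * (s / L)"
      using card_int_real_interval(2)[of "s * (j / L) - \<delta>" "s * ((j + 1) / L) + \<delta>"] assms
      by linarith
  qed (use assms Q s in auto)
  also have "\<dots> = 8 * \<delta> * W + 12 * (s / L)"
    using assms s by (simp add: Q_def field_simps)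
  finally show "real (card ?N) \<le> 8 * \<delta> * W + 12 * (s / L)" .
qed

section \<open>Numbers of the form $2^i 3^j$\<close>

definition smooth_numbers :: "nat set" where
  "smooth_numbers = {2 ^ i * 3 ^ j |i j. True}"

lemma pow2_mult_pow3_inj:
  assumes "2 ^ i * 3 ^ j = (2 ^ i' * 3 ^ j' :: nat)"
  shows "i = i' \<and> j = j'"
proof -
  have *: "i \<le> i' \<and> j \<le> j'" if eq: "2 ^ i * 3 ^ j = (2 ^ i' * 3 ^ j' :: nat)" for i j i' j'
  proof
    have cop: "coprime (2 ^ a) (3 ^ b :: nat)" for a b
      by simp
    have "(2::nat) ^ i dvd 2 ^ i' * 3 ^ j'" using eq by (metis dvd_triv_left)
    then have "(2::nat) ^ i dvd 2 ^ i'" using cop coprime_dvd_mult_left_iff by blast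
    then show "i \<le> i'" by (simp add: dvd_power_iff_le)
    have "(3::nat) ^ j dvd 2 ^ i' * 3 ^ j'" using eq by (metis dvd_triv_right)
    then have "(3::nat) ^ j dvd 3 ^ j'"
      using cop coprime_commute coprime_dvd_mult_right_iff by blast
    then show "j \<le> j'" by (simp add: dvd_power_iff_le)
  qed
  show ?thesis using *[OF assms] *[OF assms[symmetric]] by simp
qed

lemma infinite_smooth_numbers: "infinite smooth_numbers"
proof -
  have "range (\<lambda>i. 2 ^ i) \<subseteq> smooth_numbers"
  proof clarify
    fix i
    have "2 ^ i = (2 ^ i * 3 ^ 0 :: nat)" by simp
    then show "2 ^ i \<in> smooth_numbers" unfolding smooth_numbers_def by blast
  qed
  moreover have "infinite (range (\<lambda>i. 2 ^ i :: nat))"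
    by (intro range_inj_infinite) (auto simp: inj_def)
  ultimately show ?thesis using finite_subset by blast
qed

lemma smooth_seq_in: "smooth_seq n \<in> smooth_numbers"
  unfolding smooth_seq_def using enumerate_in_set[OF infinite_smooth_numbers]
  by (simp add: smooth_numbers_def)

text \<open>Since \<open>3 \<le> 4\<close>, all \<open>2 ^ i * 3 ^ j\<close> with
  \<open>i \<le> m div 2\<close> and \<open>j \<le> m div 4\<close> are at most
  \<open>2 ^ m\<close>, so these distinct numbers, at least \<open>(m + 1)^2 / 8\<close> of them,
  occur among the first \<open>n\<close> terms.\<close>

lemma smooth_seq_index_ge:
  assumes n: "n \<ge> 1" and m: "2 ^ m \<le> smooth_seq n"
  shows "(m + 1)\<^sup>2 \<le> 8 * n"
proof -
  let ?f = "\<lambda>(i, j). 2 ^ i * 3 ^ j :: nat"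
  let ?D = "{..m div 2} \<times> {..m div 4}"
  have sub: "?f ` ?D \<subseteq> enumerate smooth_numbers ` {..<n}"
  proof clarify
    fix i j assume "i \<le> m div 2" "j \<le> m div 4"
    then have ij: "i + 2 * j \<le> m" by linarith
    have "2 ^ i * 3 ^ j \<le> 2 ^ i * (2\<^sup>2 :: nat) ^ j"
      by (rule mult_left_mono, rule power_mono) simp_all
    also have "\<dots> = (2::nat) ^ (i + 2 * j)" by (simp only: power_mult power_add)
    also have "\<dots> \<le> 2 ^ m" using ij by (intro power_increasing) auto
    also have "\<dots> \<le> enumerate smooth_numbers (n - 1)"
      using m unfolding smooth_seq_def smooth_numbers_def .
    finally have le: "2 ^ i * 3 ^ j \<le> enumerate smooth_numbers (n - 1)" .
    have "2 ^ i * 3 ^ j \<in> smooth_numbers" unfolding smooth_numbers_def by blast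
    from enumerate_Ex[OF infinite_smooth_numbers this] obtain k where k: "enumerate smooth_numbers k = 2 ^ i * 3 ^ j" ..
    have "k \<le> n - 1"
    proof (rule ccontr)
      assume "\<not> k \<le> n - 1"
      then have "enumerate smooth_numbers (n - 1) < enumerate smooth_numbers k"
        by (intro enumerate_mono[OF _ infinite_smooth_numbers]) auto
      then show False using le k by linarith
    qed
    then show "2 ^ i * 3 ^ j \<in> enumerate smooth_numbers ` {..<n}"
      unfolding k[symmetric] using n by (intro imageI) simp
  qed
  have "card (?f ` ?D) \<le> card (enumerate smooth_numbers ` {..<n})"
    by (rule card_mono[OF _ sub]) simp
  also have "\<dots> \<le> n"
    using card_image_le[of "{..<n}" "enumerate smooth_numbers"] by simp
  finally have "card (?f ` ?D) \<le> n" .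
  moreover have "card (?f ` ?D) = card ?D"
  proof (rule card_image)
    show "inj_on ?f ?D"
    proof (rule inj_onI, clarify)
      fix i j i' j' assume "2 ^ i * 3 ^ j = (2 ^ i' * 3 ^ j' :: nat)"
      then show "i = i' \<and> j = j'" by (rule pow2_mult_pow3_inj)
    qed
  qed
  moreover have "card ?D = (m div 2 + 1) * (m div 4 + 1)"
    by (simp add: card_cartesian_product)
  ultimately have *: "(m div 2 + 1) * (m div 4 + 1) \<le> n" by (simp only:)
  have "m + 1 \<le> 2 * (m div 2 + 1)" by presburger
  moreover have "m + 1 \<le> 4 * (m div 4 + 1)" by presburger
  ultimately have "(m + 1) * (m + 1) \<le> (2 * (m div 2 + 1)) * (4 * (m div 4 + 1))"
    by (rule mult_le_mono)
  also have "\<dots> = 8 * ((m div 2 + 1) * (m div 4 + 1))" by (simp add: algebra_simps)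
  also have "\<dots> \<le> 8 * n" using * by (rule mult_left_mono) simp
  finally show ?thesis by (simp only: power2_eq_square)
qed

text \<open>For fixed \<open>j\<close> the admissible \<open>i\<close> start at \<open>a j\<close>
  and end before \<open>a j + h\<close>, because \<open>h\<close> doublings leave the window. Only
  \<open>j < m + h\<close> can occur, as \<open>2 ^ j \<le> 3 ^ j\<close>.\<close>

lemma card_smooth_window:
  "finite {s \<in> smooth_numbers. 2 ^ m \<le> s \<and> s < 2 ^ (m + h)}"
  "card {s \<in> smooth_numbers. 2 ^ m \<le> s \<and> s < 2 ^ (m + h)} \<le> (m + h) * h"
proof -
  let ?S = "{s \<in> smooth_numbers. 2 ^ m \<le> s \<and> s < 2 ^ (m + h)}"
  define a where "a j = (LEAST i. 2 ^ m \<le> (2 ^ i * 3 ^ j :: nat))" for j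
  let ?U = "\<Union>j\<in>{..<m + h}. (\<lambda>i. 2 ^ i * 3 ^ j :: nat) ` {a j..<a j + h}"
  show "finite ?S" by (rule finite_subset[of _ "{..<2 ^ (m + h)}"]) auto
  have "?S \<subseteq> ?U"
  proof
    fix s assume s: "s \<in> ?S"
    then obtain i j where ij: "s = 2 ^ i * 3 ^ j" by (auto simp: smooth_numbers_def)
    have "(2::nat) ^ j \<le> 3 ^ j" by (intro power_mono) auto
    also have "\<dots> \<le> s" by (simp add: ij)
    also have "\<dots> < 2 ^ (m + h)" using s by simp
    finally have j: "j < m + h" by simp
    have i: "2 ^ m \<le> (2 ^ i * 3 ^ j :: nat)" using s ij by simp
    have "a j \<le> i" unfolding a_def using i by (rule Least_le)
    moreover have "i < a j + h"
    proof (rule ccontr)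
      assume "\<not> i < a j + h"
      have "(2::nat) ^ (m + h) \<le> (2 ^ a j * 3 ^ j) * 2 ^ h"
        unfolding power_add a_def
        using LeastI[of "\<lambda>i. 2 ^ m \<le> (2 ^ i * 3 ^ j :: nat)" i, OF i] by (rule mult_right_mono) simp
      also have "\<dots> = 2 ^ (a j + h) * 3 ^ j" by (simp add: power_add)
      also have "\<dots> \<le> s"
        unfolding ij using \<open>\<not> i < a j + h\<close> by (intro mult_right_mono power_increasing) auto
      finally show False using s by simp
    qed
    ultimately have "s \<in> (\<lambda>i. 2 ^ i * 3 ^ j) ` {a j..<a j + h}"
      unfolding ij by (intro imageI) simp
    then show "s \<in> ?U" using j by blast
  qed
  then have "card ?S \<le> card ?U" by (intro card_mono) auto
  also have "\<dots> \<le> (\<Sum>j\<in>{..<m + h}. card ((\<lambda>i. 2 ^ i * 3 ^ j :: nat) ` {a j..<a j + h}))"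
    by (intro card_UN_le) auto
  also have "\<dots> \<le> (\<Sum>j\<in>{..<m + h}. h)"
    by (intro sum_mono order.trans[OF card_image_le]) auto
  finally show "card ?S \<le> (m + h) * h" by simp
qed

section \<open>The sequence of dyadic levels and its growth\<close>

definition step :: "nat \<Rightarrow> nat" where
  "step m = 10 + 2 * floor_log (m + 1)"

primrec level :: "nat \<Rightarrow> nat" where
  "level 0 = 0"
| "level (Suc k) = level k + step (level k)"

text \<open>The quadratic size makes the end-effect term of \<open>card_nodes_near_fraction\<close>,
  summed over a window, a small fraction of all cells. Of \<open>2 ^ 10 = 4 * 256\<close>, the
  factor 4 pays for rounding the logarithm down.\<close>

lemma step_lower: "256 * (m + 1)\<^sup>2 \<le> 2 ^ step m"
proof -
  have "(m + 1)\<^sup>2 \<le> (2 * 2 ^ floor_log (m + 1))\<^sup>2"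
    by (intro power_mono floor_log_exp2_ge) auto
  then show ?thesis
    by (simp add: step_def power_add power_mult power_mult_distrib power2_eq_square algebra_simps)
qed

lemma step_upper: "real (step m) \<le> 24 * ln (real m + 2)"
proof -
  have "real (2 ^ floor_log (m + 1)) \<le> real (m + 1)"
    using floor_log_exp2_le[of "m + 1"] by (simp only: of_nat_le_iff)
  then have "ln (2 ^ floor_log (m + 1)) \<le> ln (real m + 2)"
    by (intro ln_mono) auto
  then have "real (floor_log (m + 1)) * ln 2 \<le> ln (real m + 2)"
    by (simp add: ln_realpow)
  \<comment> \<open>This yields \<open>10 \<le> 20 * ln (m + 2)\<close> and
    \<open>2 * floor_log (m + 1) \<le> 4 * ln (m + 2)\<close>, together the constant 24.\<close>
  moreover have "ln 2 \<ge> (1/2::real)" using ln2_ge_two_thirds by simp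
  then have "real (floor_log (m + 1)) * (1/2) \<le> real (floor_log (m + 1)) * ln 2"
    by (intro mult_left_mono) auto
  moreover have "ln (real m + 2) \<ge> ln 2" by (intro ln_mono) auto
  moreover have "real (step m) = 10 + 2 * real (floor_log (m + 1))" by (simp add: step_def)
  ultimately show ?thesis using \<open>ln 2 \<ge> 1/2\<close> by linarith
qed

lemma level_ge: "level k \<ge> k"
  by (induction k) (auto simp: step_def)

lemma prod_pow_step: "(\<Prod>j<k. 2 ^ step (level j)) = (2::nat) ^ level k"
  by (induction k) (auto simp: power_add)

text \<open>Steps tend to infinity, so from some level on each contributes at least 2 to
  \<open>(1 - d) * level k\<close>, matching one factor 4. The finitely many earlier levels go into
  \<open>C\<close>.\<close>

lemma level_growth:
  assumes "d < (1::real)"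
  shows "\<exists>C. \<forall>k. 4 ^ Suc k \<le> C * (2 ^ level k) powr (1 - d)"
proof -
  obtain k0 where "2 / (1 - d) \<le> real k0" using real_arch_simple by blast
  then have k0: "2 \<le> real k0 * (1 - d)" using assms by (simp add: field_simps)
  have step: "2 \<le> (1 - d) * real (step (level k))" if "k \<ge> 2 ^ k0" for k
  proof -
    have "k0 = floor_log (2 ^ k0)" by simp
    also have "\<dots> \<le> floor_log (level k + 1)"
      using that level_ge[of k] by (intro floor_log_le_iff) linarith
    also have "\<dots> \<le> step (level k)" by (simp add: step_def)
    finally have "real k0 * (1 - d) \<le> real (step (level k)) * (1 - d)"
      using assms by (intro mult_right_mono) auto
    then show ?thesis using k0 by (simp add: mult.commute)
  qed
  have bound: "2 * real (Suc k) \<le> 2 * real (Suc (2 ^ k0)) + (1 - d) * real (level k)" for k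
  proof (induction k)
    case (Suc k)
    show ?case
    proof (cases "k \<ge> 2 ^ k0")
      case True
      then show ?thesis using Suc step[OF True] by (simp add: algebra_simps)
    next
      case False
      then have "Suc k \<le> 2 ^ k0" by simp
      then have "real (Suc k) \<le> real (2 ^ k0)" by (simp only: of_nat_le_iff)
      moreover have "0 \<le> (1 - d) * real (level (Suc k))" using assms by simp
      ultimately show ?thesis by simp
    qed
  qed (use assms in simp)
  have "4 ^ Suc k \<le> 2 powr (2 * real (Suc (2 ^ k0))) * (2 ^ level k) powr (1 - d)" for k
  proof -
    have "(4::real) ^ Suc k = 2 powr (2 * real (Suc k))"
      by (simp add: powr_realpow[symmetric] powr_powr[symmetric] del: power_Suc of_nat_Suc)
    also have "\<dots> \<le> 2 powr (2 * real (Suc (2 ^ k0)) + (1 - d) * real (level k))"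
      using bound[of k] by (intro powr_mono) auto
    also have "\<dots> = 2 powr (2 * real (Suc (2 ^ k0))) * (2 ^ level k) powr (1 - d)"
      by (simp add: powr_add powr_realpow[symmetric] powr_powr mult.commute del: of_nat_Suc)
    finally show ?thesis .
  qed
  then show ?thesis by blast
qed

section \<open>The tree for the smooth numbers\<close>

definition window :: "nat \<Rightarrow> nat set" where
  "window k = {s \<in> smooth_numbers. 2 ^ level k \<le> s \<and> s < 2 ^ level (Suc k)}"

text \<open>The reciprocal of the bound on \<open>card (window k)\<close> from
  \<open>card_smooth_window\<close>; 128 makes the measure terms of a whole window add up to one
  sixteenth.\<close>

definition radius :: "nat \<Rightarrow> real" where
  "radius k = 1 / (128 * real (level (Suc k)) * real (step (level k)))"

text \<open>The inequality is not strict and a single point \<open>x\<close> condemns the whole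
  cell, so every point of a surviving cell is strictly farther than \<open>radius k\<close> from the
  integers.\<close>

fun bad :: "nat \<Rightarrow> nat set" where
  "bad (Suc (Suc k)) = {i. \<exists>s\<in>window k. \<exists>x\<in>node (2 ^ level (Suc (Suc k))) i.
     \<exists>p::int. \<bar>real s * x - real_of_int p\<bar> \<le> radius k}"
| "bad k = {}"

text \<open>Each of at most \<open>c\<close> numbers \<open>s\<close> spoils at most
  \<open>8 * radius k * B * A + 12 * A\<close> cells. Both parts sum to at most
  \<open>B * A / 16\<close>: the first by the choice of \<open>radius\<close>, the second by
  \<open>step_lower\<close>.\<close>

lemma bad_sparse:
  "8 * card {i \<in> bad (Suc (Suc k)). i div 2 ^ step (level (Suc k)) div 2 ^ step (level k) = j}
     \<le> 2 ^ step (level k) * 2 ^ step (level (Suc k))"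
proof -
  define A B :: nat where "A = 2 ^ step (level k)" and "B = 2 ^ step (level (Suc k))"
  define c where "c = level (Suc k) * step (level k)"
  have h: "step (level k) \<ge> 10" "level (Suc k) \<ge> 10" by (auto simp: step_def)
  have c: "c \<ge> 1" using h by (simp add: c_def del: level.simps)
  have radius: "radius k = 1 / (128 * real c)" by (simp add: radius_def c_def)
  have r: "radius k > 0" "radius k \<le> 1" using c by (auto simp: radius divide_le_eq)
  have AB: "A > 0" "B > 0" by (auto simp: A_def B_def)
  have lev: "(2::real) ^ level (Suc (Suc k)) = 2 ^ level k * real (B * A)"
    by (simp add: A_def B_def power_add)
  let ?N = "\<lambda>s::nat. {i. i div (B * A) = j \<and> (\<exists>x\<in>node (2 ^ level k * real (B * A)) i.
     \<exists>p::int. \<bar>real s * x - real_of_int p\<bar> \<le> radius k)}"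
  have win: "finite (window k)" "card (window k) \<le> c"
    using card_smooth_window[of "level k" "step (level k)"] by (auto simp: window_def c_def)
  have ge: "2 ^ level k \<le> real s" if "s \<in> window k" for s
  proof -
    have "2 ^ level k \<le> s" using that by (simp add: window_def)
    then have "real (2 ^ level k) \<le> real s" by (simp only: of_nat_le_iff)
    then show ?thesis by simp
  qed
  have fin: "finite (?N s)" if "s \<in> window k" for s
    by (rule card_nodes_near_fraction(1)) (use ge[OF that] r AB in auto)
  have "{i \<in> bad (Suc (Suc k)). i div B div A = j} \<subseteq> (\<Union>s\<in>window k. ?N s)"
    unfolding bad.simps lev div_mult2_eq by blast
  then have "card {i \<in> bad (Suc (Suc k)). i div B div A = j} \<le> card (\<Union>s\<in>window k. ?N s)"
    using win fin by (intro card_mono) auto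
  also have "\<dots> \<le> (\<Sum>s\<in>window k. card (?N s))" by (intro card_UN_le win)
  finally have "real (card {i \<in> bad (Suc (Suc k)). i div B div A = j})
      \<le> (\<Sum>s\<in>window k. real (card (?N s)))" by (simp flip: of_nat_sum)
  also have "\<dots> \<le> (\<Sum>s\<in>window k. 8 * radius k * real (B * A) + 12 * A)"
  proof (rule sum_mono)
    fix s assume s: "s \<in> window k"
    have "s \<le> 2 ^ level k * A"
      using s by (simp add: window_def A_def power_add)
    then have "real s \<le> real (2 ^ level k * A)" by (simp only: of_nat_le_iff)
    then have "real s / 2 ^ level k \<le> A" by (simp add: field_simps)
    moreover have "real (card (?N s)) \<le> 8 * radius k * real (B * A) + 12 * (real s / 2 ^ level k)"
      by (rule card_nodes_near_fraction(2)) (use ge[OF s] r AB in auto)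
    ultimately show "real (card (?N s)) \<le> 8 * radius k * real (B * A) + 12 * A" by linarith
  qed
  also have "\<dots> = real (card (window k)) * (8 * radius k * real (B * A) + 12 * A)" by simp
  also have "\<dots> \<le> real c * (8 * radius k * real (B * A) + 12 * A)"
    using win r by (intro mult_right_mono) auto
  also have "\<dots> = real (B * A) / 16 + real (12 * c * A)"
    using c by (simp add: radius field_simps)
  also have "\<dots> \<le> real (B * A) / 16 + real (B * A) / 16"
  proof -
    have "c \<le> (level (Suc k) + 1)\<^sup>2"
      unfolding c_def power2_eq_square by (intro mult_le_mono) auto
    then have "192 * c \<le> B" using step_lower[of "level (Suc k)"] unfolding B_def by linarith
    then have "192 * c * A \<le> B * A" by (rule mult_right_mono) simp
    then have "real (192 * c * A) \<le> real (B * A)" by (simp only: of_nat_le_iff)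
    then have "16 * real (12 * c * A) \<le> real (B * A)" by simp
    then show ?thesis by linarith
  qed
  finally have "8 * real (card {i \<in> bad (Suc (Suc k)). i div B div A = j}) \<le> real (B * A)"
    by linarith
  then have "real (8 * card {i \<in> bad (Suc (Suc k)). i div B div A = j}) \<le> real (B * A)"
    by (simp only: of_nat_mult of_nat_numeral)
  then have "8 * card {i \<in> bad (Suc (Suc k)). i div B div A = j} \<le> B * A"
    by (simp only: of_nat_le_iff)
  then show ?thesis by (simp add: A_def B_def mult.commute del: bad.simps)
qed

interpretation smooth_tree:
  cantor_tree "\<lambda>k. 2 ^ step (level k)" "pruned_tree (\<lambda>k. 2 ^ step (level k)) bad"
proof (rule cantor_tree_pruned_tree)
  show "2 \<le> (2::nat) ^ step (level k)" for k
    using power_increasing[of 1 "step (level k)" "2::nat"] by (simp add: step_def)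
qed (use bad_sparse in \<open>auto simp del: bad.simps(1) level.simps\<close>)

lemma smooth_tree_L: "smooth_tree.L k = 2 ^ level k"
  unfolding smooth_tree.L_def prod_pow_step by simp

lemma limit_set_avoids:
  assumes "x \<in> smooth_tree.limit_set" "s \<in> window k"
  shows "dist_nearest_int (real s * x) > radius k"
proof -
  obtain i where i: "i \<in> pruned_tree (\<lambda>k. 2 ^ step (level k)) bad (Suc (Suc k))"
      "x \<in> node (2 ^ level (Suc (Suc k))) i"
    using assms(1) unfolding smooth_tree.limit_set_def smooth_tree_L by blast
  have "i \<notin> bad (Suc (Suc k))" using i(1) unfolding pruned_tree.simps(2) by blast
  then have far: "\<And>p::int. \<bar>real s * x - p\<bar> > radius k" using i(2) assms(2) by (auto simp: not_le)
  \<comment> \<open>The integers are closed, so the distance is attained and the strict inequality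
    survives the infimum.\<close>
  obtain y where y: "y \<in> \<int>" "dist_nearest_int (real s * x) = dist (real s * x) y"
    unfolding dist_nearest_int_def
    using infdist_attains_inf[of "\<int> :: real set"] closed_Ints Ints_0 by blast
  then show ?thesis using far by (auto simp: dist_real_def elim!: Ints_cases)
qed

lemma limit_set_subset_unit: "smooth_tree.limit_set \<subseteq> {0..1}"
  unfolding smooth_tree.limit_set_def
  by (auto simp: node_def smooth_tree_L dest!: spec[of _ 0])

text \<open>With \<open>m = level k\<close>, \<open>smooth_seq_index_ge\<close> bounds
  \<open>m + 1\<close> by \<open>3 * sqrt n\<close> and \<open>ln (m + 2)\<close> by
  \<open>8 * ln (n + 1)\<close>. The constant is \<open>128 * 25 * 24 * 3 * 8 = 1843200\<close>,
  rounded up.\<close>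

lemma radius_ge:
  assumes n: "n \<ge> 1" and m: "2 ^ level k \<le> smooth_seq n"
  shows "1 / 2000000 / (sqrt (real n) * ln (real n + 1)) \<le> radius k"
proof -
  define m where "m = level k"
  define l where "l = ln (real m + 2)"
  have sq: "(real m + 1)\<^sup>2 \<le> 8 * real n"
  proof -
    have "real ((m + 1)\<^sup>2) \<le> real (8 * n)"
      using smooth_seq_index_ge[OF assms] by (simp only: of_nat_le_iff m_def)
    then show ?thesis by (simp add: add.commute)
  qed
  have l: "0 < l" "l \<le> real m + 1" using ln_add_one_self_le_self[of "real m + 1"]
    by (auto simp: l_def add.commute)
  have "(real m + 1)\<^sup>2 \<le> 3\<^sup>2 * real n" using sq by simp
  then have "sqrt ((real m + 1)\<^sup>2) \<le> sqrt (3\<^sup>2 * real n)" by (rule real_sqrt_le_mono)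
  then have s: "(real m + 1) / 3 \<le> sqrt (real n)" by (simp add: real_sqrt_mult)
  \<comment> \<open>Bernoulli turns the linear bound \<open>1 + 8 * n\<close> into a power, whose
    logarithm is a multiple of \<open>ln (n + 1)\<close>.\<close>
  have "real m + 2 \<le> (1 + real n) ^ 8"
  proof -
    have "1 * (real m + 1) \<le> (real m + 1)\<^sup>2"
      unfolding power2_eq_square by (intro mult_right_mono) auto
    then have "real m + 2 \<le> 1 + real 8 * real n" using sq by simp
    also have "\<dots> \<le> (1 + real n) ^ 8" by (intro Bernoulli_inequality) auto
    finally show ?thesis .
  qed
  then have "l \<le> ln ((1 + real n) ^ 8)" unfolding l_def by (intro ln_mono) auto
  also have "\<dots> = 8 * ln (real n + 1)" by (simp add: ln_realpow add.commute)
  finally have ln: "l / 8 \<le> ln (real n + 1)" by simp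
  have step: "real (step m) \<le> 24 * l" unfolding l_def by (rule step_upper)
  have lev: "real (level (Suc k)) \<le> 25 * (real m + 1)"
    using step l(2) by (simp add: m_def)
  have pos: "real (level (Suc k)) > 0" "real (step m) > 0" by (auto simp: step_def)
  have "128 * real (level (Suc k)) * real (step m) \<le> 128 * (25 * (real m + 1)) * (24 * l)"
    using step lev l pos by (intro mult_mono) auto
  also have "\<dots> = 1843200 * ((real m + 1) / 3 * (l / 8))" by simp
  also have "\<dots> \<le> 1843200 * (sqrt (real n) * ln (real n + 1))"
    using s ln l by (intro mult_left_mono mult_mono) auto
  also have "\<dots> \<le> 2000000 * (sqrt (real n) * ln (real n + 1))"
    by (intro mult_right_mono) auto
  finally have "1 / (2000000 * (sqrt (real n) * ln (real n + 1)))
      \<le> 1 / (128 * real (level (Suc k)) * real (step m))"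
    using pos by (intro frac_le) auto
  then show ?thesis by (simp add: radius_def m_def)
qed

lemma limit_set_badly_approximable:
  assumes x: "x \<in> smooth_tree.limit_set" and n: "n \<ge> 1"
  shows "dist_nearest_int (real (smooth_seq n) * x) > 1 / 2000000 / (sqrt (real n) * ln (real n + 1))"
proof -
  let ?s = "smooth_seq n"
  have "?s > 0" using smooth_seq_in[of n] by (auto simp: smooth_numbers_def)
  \<comment> \<open>The window containing \<open>s_n\<close>: minimality gives its lower end, and
    for \<open>k = 0\<close> that end is 1 because \<open>level 0 = 0\<close>.\<close>
  define k where "k = (LEAST k. ?s < 2 ^ level (Suc k))"
  have "?s < 2 ^ ?s" by simp
  also have "\<dots> \<le> (2::nat) ^ level (Suc ?s)"
    using level_ge[of "Suc ?s"] by (intro power_increasing) auto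
  finally have k1: "?s < 2 ^ level (Suc k)" unfolding k_def by (rule LeastI)
  have k2: "2 ^ level k \<le> ?s"
  proof (cases k)
    case (Suc k')
    then have "\<not> ?s < 2 ^ level (Suc k')" unfolding k_def by (intro not_less_Least) simp
    then show ?thesis using Suc by simp
  qed (use \<open>?s > 0\<close> in simp)
  have "?s \<in> window k" using k1 k2 smooth_seq_in by (simp add: window_def)
  then have "dist_nearest_int (real ?s * x) > radius k" by (rule limit_set_avoids[OF x])
  then show ?thesis using radius_ge[OF n k2] by linarith
qed

theorem mainTheorem2:
  "hausdorff_dim
     {\<alpha> \<in> {0..1::real}. \<exists>\<kappa>>0. \<forall>n::nat. n \<ge> 1 \<longrightarrow>
        dist_nearest_int (real (smooth_seq n) * \<alpha>) > \<kappa> / (sqrt (real n) * ln (real n + 1))} = 1"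
proof (rule hausdorff_dim_eq_1I)
  let ?F = "{\<alpha> \<in> {0..1::real}. \<exists>\<kappa>>0. \<forall>n::nat. n \<ge> 1 \<longrightarrow>
    dist_nearest_int (real (smooth_seq n) * \<alpha>) > \<kappa> / (sqrt (real n) * ln (real n + 1))}"
  have "smooth_tree.limit_set \<subseteq> ?F"
  proof
    fix \<alpha> assume \<alpha>: "\<alpha> \<in> smooth_tree.limit_set"
    then have "\<alpha> \<in> {0..1}" using limit_set_subset_unit by blast
    moreover have "\<forall>n\<ge>1. dist_nearest_int (real (smooth_seq n) * \<alpha>)
        > 1 / 2000000 / (sqrt (real n) * ln (real n + 1))"
      using limit_set_badly_approximable[OF \<alpha>] by blast
    ultimately show "\<alpha> \<in> ?F"
      \<comment> \<open>One constant \<open>\<kappa>\<close> serves all points of the limit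
        set.\<close>
      by (intro CollectI conjI exI[of _ "1 / 2000000"]) auto
  qed
  fix d :: real assume d: "0 < d" "d < 1"
  then obtain C where "\<And>k. 4 ^ Suc k \<le> C * smooth_tree.L k powr (1 - d)"
    using level_growth[of d] unfolding smooth_tree_L by blast
  then show "hausdorff_measure d ?F \<noteq> 0"
    using d \<open>smooth_tree.limit_set \<subseteq> ?F\<close> by (rule smooth_tree.hausdorff_measure_pos)
qed auto

end
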